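(* Let $n\ge 3$ be odd and let $C,\widetilde C$ be self-dual codes in $\mathbb{F}_2^{n+1}$. Then there exists an orthogonal matrix $P\in\mathcal{O}_n(\mathbb{F}_2)$ such that $\widetilde C=(P\oplus 1)C$ and, moreover, for every basis $\mathcal{B}=\{\mathbf{y}_1,\ldots,\mathbf{y}_m\}\in\mathfrak{B}_C$, the set $\widetilde{\mathcal{B}}=\{(P\oplus1)\mathbf{y}_1,\ldots,(P\oplus1)\mathbf{y}_m\}$ lies in $\mathfrak{B}_{\widetilde C}$ and: (i) $\mathcal{B}\in\mathfrak{B}_C^2$ iff $\widetilde{\mathcal{B}}\in\mathfrak{B}_{\widetilde C}^2$; (ii) if $A'_{\mathcal{B}}\in\mathcal{F}_C$ then $PA'_{\mathcal{B}}P^{\top}=A'_{\widetilde{\mathcal{B}}}\in\mathcal{F}_{\widetilde C}$; (iii) if $A''_{\mathcal{B}}\in\mathcal{F}_C$ then $PA''_{\mathcal{B}}P^{\top}=A''_{\widetilde{\mathcal{B}}}\in\mathcal{F}_{\widetilde C}$; (iv) $\{PAP^{\top}:A\in\mathcal{F}_C\}=\mathcal{F}_{\widetilde C}$.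
   Context: $\mathbb{F}_2$ is the binary field. $\mathcal{O}_n(\mathbb{F}_2)$ is the group of $P\in GL_n(\mathbb{F}_2)$ with $P^{\top}=P^{-1}$; $P\oplus 1$ is the $(n+1)\times(n+1)$ block-diagonal matrix with blocks $P$ and $1$, and $(P\oplus1)C=\{(P\oplus1)\mathbf{y}:\mathbf{y}\in C\}$. A code $C\subseteq\mathbb{F}_2^{n+1}$ is self-dual if $C=C^\perp$ (standard dot product); then $\dim C=m:=\frac{n+1}{2}$. For $\mathbf{y}\in\mathbb{F}_2^{n+1}$, $\underline{\mathbf{y}}\in\mathbb{F}_2^n$ is $\mathbf{y}$ with its last entry deleted; $\mathbf{x}^2:=\mathbf{x}\mathbf{x}^{\top}$. $\mathfrak{B}_C$ is the set of bases of $C$, $\mathfrak{B}_C^2$ those bases containing an even number of vectors with last entry $1$. For $\mathcal{B}=\{\mathbf{y}_1,\ldots,\mathbf{y}_m\}\in\mathfrak{B}_C$, $A'_{\mathcal{B}}=I_n+\sum_{i=1}^m\underline{\mathbf{y}_i}^2$ and $A''_{\mathcal{B}}=I_n+\sum_{i=1}^m\underline{\mathbf{y}_i}^2+(\underline{\mathbf{y}_1}+\cdots+\underline{\mathbf{y}_m})^2$. $\mathcal{F}_C=\{A'_{\mathcal{B}}:\mathcal{B}\in\mathfrak{B}_C^2\}\cup\{A''_{\mathcal{B}}:\mathcal{B}\in\mathfrak{B}_C\}$ if $m$ is even, and $\mathcal{F}_C=\{A'_{\mathcal{B}}:\mathcal{B}\in\mathfrak{B}_C^2\}$ if $m$ is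 odd. *)

theory Defs
  imports "HOL-Analysis.Analysis" "HOL-Library.Z2"
begin

text \<open>Vectors in F_2^(n+1) are modelled as bit^('n option); the coordinate None is the
  distinguished last coordinate, Some i (i :: 'n) are the first n coordinates.
  n = CARD('n).\<close>

definition dotp :: "bit ^ 'k::finite \<Rightarrow> bit ^ 'k::finite \<Rightarrow> bit" where
  "dotp x y = (\<Sum>i\<in>UNIV. x $ i * y $ i)"

definition dual_code :: "(bit ^ 'k::finite) set \<Rightarrow> (bit ^ 'k) set" where
  "dual_code C = {x. \<forall>y\<in>C. dotp x y = 0}"

definition self_dual :: "(bit ^ 'k::finite) set \<Rightarrow> bool" where
  "self_dual C \<longleftrightarrow> C = dual_code C"

text \<open>underline y: delete the last entry\<close>
definition trunc :: "bit ^ ('n::finite option) \<Rightarrow> bit ^ 'n" where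
  "trunc y = (\<chi> i. y $ Some i)"

text \<open>x^2 := x x^T for a column vector x (an n x n matrix)\<close>
definition sqv :: "bit ^ 'n::finite \<Rightarrow> bit ^ 'n ^ 'n" where
  "sqv x = (\<chi> i j. x $ i * x $ j)"

text \<open>P \<oplus> 1\<close>
definition ext1 :: "bit ^ 'n ^ 'n \<Rightarrow> bit ^ ('n::finite option) ^ ('n option)" where
  "ext1 P = (\<chi> i j. case (i, j) of (Some a, Some b) \<Rightarrow> P $ a $ b
                                  | (None, None) \<Rightarrow> 1
                                  | _ \<Rightarrow> 0)"

text \<open>the set of bases of C\<close>
definition bases :: "(bit ^ 'k::finite) set \<Rightarrow> (bit ^ 'k) set set" where
  "bases C = {B. B \<subseteq> C \<and> vec.independent B \<and> vec.span B = C}"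

text \<open>bases with an even number of vectors whose last entry is 1\<close>
definition bases2 :: "(bit ^ ('n::finite option)) set \<Rightarrow> (bit ^ ('n::finite option)) set set" where
  "bases2 C = {B \<in> bases C. even (card {y \<in> B. y $ None = 1})}"

definition A1 :: "(bit ^ ('n::finite option)) set \<Rightarrow> bit ^ 'n ^ 'n" where
  "A1 B = mat 1 + (\<Sum>y\<in>B. sqv (trunc y))"

definition A2 :: "(bit ^ ('n::finite option)) set \<Rightarrow> bit ^ 'n ^ 'n" where
  "A2 B = mat 1 + (\<Sum>y\<in>B. sqv (trunc y)) + sqv (\<Sum>y\<in>B. trunc y)"

text \<open>m = (n+1)/2\<close>
definition FC :: "(bit ^ ('n::finite option)) set \<Rightarrow> (bit ^ 'n ^ 'n) set" where
  "FC C = (if even (CARD('n option) div 2)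
           then A1 ` bases2 C \<union> A2 ` bases C
           else A1 ` bases2 C)"

end

theory Submission
  imports Defs
begin

(* If C \<noteq> C', pick x \<in> C and y \<in> C' with x \<cdot> y = 1 and equal last entries
   (replacing x by x + 1 if necessary: the all-ones vector lies in every self-dual code).
   Then a = x + y is isotropic with last entry 0, so the transvection z \<mapsto> z + (z \<cdot> a) a
   is an orthogonal map of the form Q \<oplus> 1; it sends x to y and fixes C \<inter> C', so the
   image of C is self-dual and meets C' in a strictly larger set.  Iterating yields P with
   C' = (P \<oplus> 1) C.  As P \<oplus> 1 maps bases to bases, preserves last entries and turns
   each y y\<^sup>T into (P y) (P y)\<^sup>T = P y y\<^sup>T P\<^sup>T, it carries A', A'' and F
   over by congruence with P. *)

(* By default simp turns + and * on bit into xor and and, which defeats ring reasoning. *)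
declare add_bit_eq_xor [simp del] mult_bit_eq_and [simp del]

instance bit :: finite
proof
  have "(UNIV :: bit set) = {0, 1}"
    by (auto intro: bit.exhaust)
  then show "finite (UNIV :: bit set)"
    by (metis finite.emptyI finite_insert)
qed

lemma bit_add_self [simp]: "(x :: bit) + x = 0"
  by (cases x) simp_all

lemma bit_mult_self [simp]: "(x :: bit) * x = x"
  by (cases x) simp_all

subsection \<open>The dot product over the binary field\<close>

lemma dotp_commute: "dotp x y = dotp y x"
  unfolding dotp_def by (simp add: mult.commute)

lemma dotp_add_left: "dotp (x + y) z = dotp x z + dotp y z"
  unfolding dotp_def by (simp add: distrib_right sum.distrib)

lemma dotp_add_right: "dotp z (x + y) = dotp z x + dotp z y"
  unfolding dotp_def by (simp add: distrib_left sum.distrib)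

lemma dotp_scale_left: "dotp (c *s x) z = c * dotp x z"
  unfolding dotp_def by (simp add: sum_distrib_left mult.assoc)

lemma dotp_scale_right: "dotp z (c *s x) = c * dotp z x"
  unfolding dotp_def by (simp add: sum_distrib_left mult.left_commute)

lemma dotp_one_left: "dotp 1 z = dotp z z"
  unfolding dotp_def by simp

lemma dotp_matrix_vector_mult: "dotp (A *v u) w = dotp u (transpose A *v w)"
proof -
  have "dotp (A *v u) w = (\<Sum>i\<in>UNIV. \<Sum>j\<in>UNIV. A $ i $ j * u $ j * w $ i)"
    unfolding dotp_def matrix_vector_mult_def by (simp add: sum_distrib_right)
  also have "\<dots> = (\<Sum>j\<in>UNIV. \<Sum>i\<in>UNIV. A $ i $ j * u $ j * w $ i)"
    by (rule sum.swap)
  also have "\<dots> = dotp u (transpose A *v w)"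
    unfolding dotp_def matrix_vector_mult_def transpose_def
    by (simp add: sum_distrib_left mult.assoc mult.left_commute)
  finally show ?thesis .
qed

lemma dotp_option:
  "dotp (x :: bit ^ 'n::finite option) y = x $ None * y $ None + dotp (trunc x) (trunc y)"
  unfolding dotp_def trunc_def by (simp add: UNIV_option_conv sum.reindex)

subsection \<open>Self-dual codes\<close>

lemma self_dual_mem_iff: "self_dual C \<Longrightarrow> x \<in> C \<longleftrightarrow> (\<forall>y\<in>C. dotp x y = 0)"
  unfolding self_dual_def dual_code_def by blast

lemma self_dual_dotp_eq_0: "self_dual C \<Longrightarrow> x \<in> C \<Longrightarrow> y \<in> C \<Longrightarrow> dotp x y = 0"
  using self_dual_mem_iff by blast

lemma self_dual_add_mem:
  assumes "self_dual C" "x \<in> C" "y \<in> C"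
  shows "x + y \<in> C"
  using assms self_dual_dotp_eq_0[OF assms(1)] self_dual_mem_iff[OF assms(1), of "x + y"]
  by (simp add: dotp_add_left)

lemma self_dual_one_mem: "self_dual C \<Longrightarrow> 1 \<in> C"
  using self_dual_mem_iff[of C 1] self_dual_dotp_eq_0[of C] by (simp add: dotp_one_left)

lemma self_dual_subset_imp_eq: "self_dual C \<Longrightarrow> self_dual D \<Longrightarrow> C \<subseteq> D \<Longrightarrow> C = D"
  using self_dual_mem_iff[of C] self_dual_mem_iff[of D] by blast

lemma self_dual_image_involution:
  assumes "self_dual C" and involution: "\<And>x. T (T x) = x"
    and isometry: "\<And>u v. dotp (T u) (T v) = dotp u v"
  shows "self_dual (T ` C)"
proof -
  have "z \<in> T ` C \<longleftrightarrow> T z \<in> C" for z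
    by (metis involution image_iff)
  moreover have "T z \<in> C \<longleftrightarrow> (\<forall>c\<in>C. dotp z (T c) = 0)" for z
    using self_dual_mem_iff[OF assms(1)] by (metis involution isometry)
  ultimately show ?thesis
    unfolding self_dual_def dual_code_def by auto
qed

lemma self_dual_exists_dotp_eq_1:
  fixes C C' :: "(bit ^ 'n::finite option) set"
  assumes C: "self_dual C" and C': "self_dual C'" and "C \<noteq> C'"
  obtains x y where "x \<in> C" "y \<in> C'" "dotp x y = 1" "x $ None = y $ None"
proof -
  obtain x where x: "x \<in> C" and "x \<notin> C'"
    using self_dual_subset_imp_eq[OF C C'] \<open>C \<noteq> C'\<close> by blast
  then obtain y where y: "y \<in> C'" and xy: "dotp x y = 1"
    using self_dual_mem_iff[OF C', of x] by auto
  show thesis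
  proof (cases "x $ None = y $ None")
    case True
    then show thesis using that x y xy by blast
  next
    case False
    have "x + 1 \<in> C"
      by (rule self_dual_add_mem[OF C x self_dual_one_mem[OF C]])
    moreover have "dotp (x + 1) y = 1"
      using xy self_dual_dotp_eq_0[OF C' y y] by (simp add: dotp_add_left dotp_one_left)
    moreover have "(x + 1) $ None = y $ None"
      using False by (cases "x $ None"; cases "y $ None") simp_all
    ultimately show thesis using that y by blast
  qed
qed

subsection \<open>Transvections\<close>

definition transvection :: "bit ^ 'k::finite \<Rightarrow> bit ^ 'k \<Rightarrow> bit ^ 'k" where
  "transvection a z = z + dotp z a *s a"

lemma transvection_transvection:
  "dotp a a = 0 \<Longrightarrow> transvection a (transvection a z) = z"
  unfolding transvection_def
  by (simp add: dotp_add_left dotp_scale_left vec_eq_iff add.assoc)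

lemma dotp_transvection:
  assumes "dotp a a = 0"
  shows "dotp (transvection a u) (transvection a v) = dotp u v"
proof -
  have "dotp (transvection a u) (transvection a v)
      = dotp u v + (dotp v a * dotp u a + dotp u a * dotp v a) + dotp u a * dotp v a * dotp a a"
    unfolding transvection_def
    by (simp add: dotp_add_left dotp_add_right dotp_scale_left dotp_scale_right
        dotp_commute[of a v] algebra_simps)
  then show ?thesis
    using assms by (simp add: mult.commute)
qed

lemma self_dual_transvection_image:
  "self_dual C \<Longrightarrow> dotp a a = 0 \<Longrightarrow> self_dual (transvection a ` C)"
  by (simp add: self_dual_image_involution transvection_transvection dotp_transvection)

lemma sqv_matrix_vector_mult: "sqv a *v x = dotp x a *s a"
  unfolding sqv_def matrix_vector_mult_def dotp_def
  by (simp add: vec_eq_iff sum_distrib_left mult_ac)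

lemma transvection_matrix: "(mat 1 + sqv a) *v z = transvection a z"
  by (simp add: transvection_def matrix_vector_mult_add_rdistrib sqv_matrix_vector_mult)

lemma transpose_sqv [simp]: "transpose (sqv a) = sqv a"
  unfolding transpose_def sqv_def by (simp add: vec_eq_iff mult.commute)

lemma transpose_add: "transpose (A + B) = transpose A + transpose B"
  unfolding transpose_def by (simp add: vec_eq_iff)

lemma orthogonal_matrix_transvection:
  assumes "dotp a a = 0"
  shows "orthogonal_matrix (mat 1 + sqv a)"
proof -
  have "(mat 1 + sqv a) ** (mat 1 + sqv a) = mat 1"
    by (simp add: matrix_eq transvection_matrix transvection_transvection[OF assms]
        flip: matrix_vector_mul_assoc)
  then show ?thesis
    unfolding orthogonal_matrix_def by (simp add: transpose_add)
qed

lemma orthogonal_matrix_mult: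
  fixes A B :: "'a::comm_semiring_1 ^ 'n ^ 'n"
  assumes "orthogonal_matrix A" "orthogonal_matrix B"
  shows "orthogonal_matrix (A ** B)"
  using assms unfolding orthogonal_matrix_def matrix_transpose_mul
  by (metis matrix_mul_assoc matrix_mul_lid)

subsection \<open>Matrices of the form \<open>P \<oplus> 1\<close>\<close>

lemma trunc_add: "trunc (u + v) = trunc u + trunc v"
  unfolding trunc_def by (simp add: vec_eq_iff)

lemma trunc_scale: "trunc (c *s u) = c *s trunc u"
  unfolding trunc_def by (simp add: vec_eq_iff)

lemma vec_option_eqI:
  "u $ None = v $ None \<Longrightarrow> trunc u = trunc v \<Longrightarrow> (u :: bit ^ 'n::finite option) = v"
  unfolding trunc_def vec_eq_iff by (metis not_None_eq vec_lambda_beta)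

lemma ext1_matrix_vector_mult_None [simp]: "(ext1 P *v y) $ None = y $ None"
  unfolding ext1_def matrix_vector_mult_def by (simp add: UNIV_option_conv sum.reindex)

lemma trunc_ext1_matrix_vector_mult [simp]: "trunc (ext1 P *v y) = P *v trunc y"
  unfolding ext1_def matrix_vector_mult_def trunc_def
  by (simp add: UNIV_option_conv sum.reindex vec_eq_iff)

lemma ext1_mult: "ext1 A *v (ext1 B *v y) = ext1 (A ** B) *v y"
  by (rule vec_option_eqI) (simp_all, simp add: matrix_vector_mul_assoc)

lemma ext1_mat_1: "ext1 (mat 1) *v y = y"
  by (rule vec_option_eqI) simp_all

lemma ext1_transpose_inverse:
  assumes "orthogonal_matrix P"
  shows "ext1 (transpose P) *v (ext1 P *v y) = y" and "ext1 P *v (ext1 (transpose P) *v y) = y"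
  using assms unfolding orthogonal_matrix_def by (simp_all add: ext1_mult ext1_mat_1)

lemma inj_ext1_matrix_vector_mult: "orthogonal_matrix P \<Longrightarrow> inj ((*v) (ext1 P))"
  by (metis injI ext1_transpose_inverse(1))

lemma ext1_transvection:
  assumes "a $ None = 0"
  shows "ext1 (mat 1 + sqv (trunc a)) *v z = transvection a z"
proof (rule vec_option_eqI)
  have "dotp z a = dotp (trunc z) (trunc a)"
    using dotp_option[of z a] assms by simp
  then show "trunc (ext1 (mat 1 + sqv (trunc a)) *v z) = trunc (transvection a z)"
    by (simp add: transvection_matrix transvection_def trunc_add trunc_scale)
qed (simp add: transvection_def assms)

subsection \<open>Any two self-dual codes are equivalent\<close>

lemma self_dual_transvection_overlap:
  assumes C: "self_dual C" and C': "self_dual C'" and x: "x \<in> C" and y: "y \<in> C'"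
    and xy: "dotp x y = 1"
  shows "C \<inter> C' \<subset> transvection (x + y) ` C \<inter> C'"
proof -
  have "transvection (x + y) l = l" if "l \<in> C \<inter> C'" for l
    using that self_dual_dotp_eq_0[OF C _ x] self_dual_dotp_eq_0[OF C' _ y]
    by (simp add: transvection_def dotp_add_right)
  then have "C \<inter> C' \<subseteq> transvection (x + y) ` C \<inter> C'"
    by (metis IntE IntI image_eqI subsetI)
  moreover have "y \<in> transvection (x + y) ` C \<inter> C'"
  proof -
    have "dotp x (x + y) = 1"
      using xy self_dual_dotp_eq_0[OF C x x] by (simp add: dotp_add_right)
    then have "transvection (x + y) x = y"
      by (simp add: transvection_def vec_eq_iff add.assoc[symmetric])
    then show ?thesis
      using x y by (metis IntI image_eqI)
  qed
  moreover have "y \<notin> C"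
    using self_dual_dotp_eq_0[OF C _ x] xy by (metis dotp_commute zero_neq_one)
  ultimately show ?thesis
    by blast
qed

lemma self_dual_overlap_increase:
  fixes C C' :: "(bit ^ 'n::finite option) set"
  assumes C: "self_dual C" and C': "self_dual C'" and "C \<noteq> C'"
  obtains Q where "orthogonal_matrix Q" "self_dual ((*v) (ext1 Q) ` C)"
    "card (C \<inter> C') < card ((*v) (ext1 Q) ` C \<inter> C')"
proof -
  obtain x y where x: "x \<in> C" and y: "y \<in> C'" and xy: "dotp x y = 1"
    and last: "x $ None = y $ None"
    using self_dual_exists_dotp_eq_1[OF C C' \<open>C \<noteq> C'\<close>] .
  define a where "a = x + y"
  define Q where "Q = mat 1 + sqv (trunc a)"
  have a_None: "a $ None = 0"
    unfolding a_def using last by simp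
  have xa: "dotp x a = 1" and ya: "dotp y a = 1"
    using xy self_dual_dotp_eq_0[OF C x x] self_dual_dotp_eq_0[OF C' y y]
    by (simp_all add: a_def dotp_add_right dotp_commute[of y x])
  have aa: "dotp a a = 0"
    using xa ya by (simp add: a_def dotp_add_left)
  have Q: "(*v) (ext1 Q) = transvection a"
    using ext1_transvection[OF a_None] by (simp add: Q_def fun_eq_iff)
  have "orthogonal_matrix Q"
    unfolding Q_def using orthogonal_matrix_transvection aa dotp_option[of a a] a_None by simp
  moreover have "self_dual (transvection a ` C)"
    by (rule self_dual_transvection_image[OF C aa])
  moreover have "C \<inter> C' \<subset> transvection a ` C \<inter> C'"
    unfolding a_def by (rule self_dual_transvection_overlap[OF C C' x y xy])
  then have "card (C \<inter> C') < card (transvection a ` C \<inter> C')"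
    by (simp add: psubset_card_mono)
  ultimately show thesis
    using that Q by simp
qed

lemma self_dual_codes_equivalent:
  fixes C C' :: "(bit ^ 'n::finite option) set"
  assumes "self_dual C" "self_dual C'"
  shows "\<exists>P. orthogonal_matrix P \<and> C' = (*v) (ext1 P) ` C"
  using assms(1)
proof (induction "card C' - card (C \<inter> C')" arbitrary: C rule: less_induct)
  case less
  show ?case
  proof (cases "C = C'")
    case True
    then show ?thesis
      using orthogonal_matrix_id by (auto simp: ext1_mat_1)
  next
    case False
    then obtain Q where Q: "orthogonal_matrix Q" "self_dual ((*v) (ext1 Q) ` C)"
      and card: "card (C \<inter> C') < card ((*v) (ext1 Q) ` C \<inter> C')"
      using self_dual_overlap_increase[OF less.prems assms(2)] by blast
    have "card ((*v) (ext1 Q) ` C \<inter> C') \<le> card C'"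
      by (simp add: card_mono)
    with card have "card C' - card ((*v) (ext1 Q) ` C \<inter> C') < card C' - card (C \<inter> C')"
      by linarith
    then obtain P where P: "orthogonal_matrix P" "C' = (*v) (ext1 P) ` (*v) (ext1 Q) ` C"
      using less.hyps[OF _ Q(2)] by blast
    then have "C' = (*v) (ext1 (P ** Q)) ` C"
      by (simp add: image_image ext1_mult)
    then show ?thesis
      using orthogonal_matrix_mult[OF P(1) Q(1)] by blast
  qed
qed

subsection \<open>Transport of bases and of the families \<open>F\<^sub>C\<close>\<close>

lemma bases_image:
  "inj ((*v) A) \<Longrightarrow> B \<in> bases C \<Longrightarrow> (*v) A ` B \<in> bases ((*v) A ` C)"
  unfolding bases_def by (auto simp: vec.independent_inj_image vec.span_image)

lemma card_last_eq_1_ext1_image: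
  assumes "orthogonal_matrix P"
  shows "card {z \<in> (*v) (ext1 P) ` B. z $ None = 1} = card {y \<in> B. y $ None = 1}"
proof -
  have "{z \<in> (*v) (ext1 P) ` B. z $ None = 1} = (*v) (ext1 P) ` {y \<in> B. y $ None = 1}"
    by auto
  then show ?thesis
    using inj_ext1_matrix_vector_mult[OF assms] by (simp add: card_image inj_on_subset)
qed

lemma bases_ext1_image:
  assumes "orthogonal_matrix P"
  shows "bases ((*v) (ext1 P) ` C) = (`) ((*v) (ext1 P)) ` bases C"
proof
  show "(`) ((*v) (ext1 P)) ` bases C \<subseteq> bases ((*v) (ext1 P) ` C)"
    using bases_image[OF inj_ext1_matrix_vector_mult[OF assms]] by blast
next
  have left_inverse: "(*v) (ext1 (transpose P)) ` (*v) (ext1 P) ` X = X" for X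
    by (simp add: image_image ext1_transpose_inverse(1)[OF assms])
  have right_inverse: "(*v) (ext1 P) ` (*v) (ext1 (transpose P)) ` X = X" for X
    by (simp add: image_image ext1_transpose_inverse(2)[OF assms])
  show "bases ((*v) (ext1 P) ` C) \<subseteq> (`) ((*v) (ext1 P)) ` bases C"
  proof
    fix B assume B: "B \<in> bases ((*v) (ext1 P) ` C)"
    have "(*v) (ext1 (transpose P)) ` B \<in> bases ((*v) (ext1 (transpose P)) ` (*v) (ext1 P) ` C)"
      using bases_image[OF inj_ext1_matrix_vector_mult B] assms by simp
    then have "(*v) (ext1 (transpose P)) ` B \<in> bases C"
      unfolding left_inverse .
    then show "B \<in> (`) ((*v) (ext1 P)) ` bases C"
      using right_inverse by (metis image_eqI)
  qed
qed

lemma bases2_ext1_image_iff: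
  assumes "orthogonal_matrix P" "B \<in> bases C"
  shows "(*v) (ext1 P) ` B \<in> bases2 ((*v) (ext1 P) ` C) \<longleftrightarrow> B \<in> bases2 C"
  using assms bases_ext1_image[OF assms(1)]
  by (auto simp: bases2_def card_last_eq_1_ext1_image)

lemma bases2_ext1_image:
  assumes "orthogonal_matrix P"
  shows "bases2 ((*v) (ext1 P) ` C) = (`) ((*v) (ext1 P)) ` bases2 C"
  using bases_ext1_image[OF assms] bases2_ext1_image_iff[OF assms]
  unfolding bases2_def by auto

lemma congruence_add:
  fixes P :: "'a::comm_semiring_1 ^ 'n ^ 'm"
  shows "P ** (A + B) ** Q = P ** A ** Q + P ** B ** Q"
  by (simp add: matrix_eq matrix_vector_mult_add_rdistrib matrix_vector_right_distrib
      flip: matrix_vector_mul_assoc)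

lemma congruence_sum:
  fixes P :: "'a::comm_semiring_1 ^ 'n ^ 'm"
  shows "P ** (\<Sum>x\<in>S. M x) ** Q = (\<Sum>x\<in>S. P ** M x ** Q)"
proof -
  have "P ** 0 ** Q = 0"
    by (simp add: matrix_eq flip: matrix_vector_mul_assoc)
  then show ?thesis
    by (induction S rule: infinite_finite_induct) (simp_all add: congruence_add)
qed

lemma sqv_matrix_vector_mult_congruence: "sqv (P *v u) = P ** sqv u ** transpose P"
proof -
  have "dotp (transpose P *v x) u = dotp x (P *v u)" for x
    using dotp_matrix_vector_mult[of "transpose P" x u] by simp
  then show ?thesis
    by (simp add: matrix_eq sqv_matrix_vector_mult vector_scalar_commute
        flip: matrix_vector_mul_assoc)
qed

lemma A1_ext1_image:
  assumes "orthogonal_matrix P"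
  shows "A1 ((*v) (ext1 P) ` B) = P ** A1 B ** transpose P"
proof -
  have "A1 ((*v) (ext1 P) ` B) = mat 1 + (\<Sum>y\<in>B. sqv (P *v trunc y))"
    unfolding A1_def
    by (simp add: sum.reindex inj_on_subset[OF inj_ext1_matrix_vector_mult[OF assms]])
  also have "\<dots> = P ** A1 B ** transpose P"
    using assms unfolding A1_def orthogonal_matrix_def
    by (simp add: congruence_add congruence_sum sqv_matrix_vector_mult_congruence)
  finally show ?thesis .
qed

lemma A2_ext1_image:
  assumes "orthogonal_matrix P"
  shows "A2 ((*v) (ext1 P) ` B) = P ** A2 B ** transpose P"
proof -
  have "A2 ((*v) (ext1 P) ` B)
      = mat 1 + (\<Sum>y\<in>B. sqv (P *v trunc y)) + sqv (P *v (\<Sum>y\<in>B. trunc y))"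
    unfolding A2_def
    by (simp add: sum.reindex inj_on_subset[OF inj_ext1_matrix_vector_mult[OF assms]] vec.sum)
  also have "\<dots> = P ** A2 B ** transpose P"
    using assms unfolding A2_def orthogonal_matrix_def
    by (simp add: congruence_add congruence_sum sqv_matrix_vector_mult_congruence)
  finally show ?thesis .
qed

lemma FC_ext1_image:
  assumes "orthogonal_matrix P"
  shows "(\<lambda>A. P ** A ** transpose P) ` FC C = FC ((*v) (ext1 P) ` C)"
  using assms
  by (simp add: FC_def image_Un image_image A1_ext1_image A2_ext1_image
      bases_ext1_image bases2_ext1_image)

theorem theorem8p10:
  fixes C Ct :: "(bit ^ ('n::finite option)) set"
  assumes "odd CARD('n)" and "CARD('n) \<ge> 3"
    and "self_dual C" and "self_dual Ct"
  shows "\<exists>P :: bit ^ 'n ^ 'n. orthogonal_matrix P \<and>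
           Ct = (\<lambda>y. ext1 P *v y) ` C \<and>
           (\<forall>B \<in> bases C.
              let Bt = (\<lambda>y. ext1 P *v y) ` B in
              Bt \<in> bases Ct \<and>
              (B \<in> bases2 C \<longleftrightarrow> Bt \<in> bases2 Ct) \<and>
              (A1 B \<in> FC C \<longrightarrow> P ** A1 B ** transpose P = A1 Bt \<and> A1 Bt \<in> FC Ct) \<and>
              (A2 B \<in> FC C \<longrightarrow> P ** A2 B ** transpose P = A2 Bt \<and> A2 Bt \<in> FC Ct)) \<and>
           (\<lambda>A. P ** A ** transpose P) ` FC C = FC Ct"
proof -
  obtain P where P: "orthogonal_matrix P" and Ct: "Ct = (*v) (ext1 P) ` C"
    using self_dual_codes_equivalent[OF assms(3,4)] by blast
  have FC: "(\<lambda>A. P ** A ** transpose P) ` FC C = FC Ct"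
    unfolding Ct by (rule FC_ext1_image[OF P])
  have "let Bt = (*v) (ext1 P) ` B in
          Bt \<in> bases Ct \<and>
          (B \<in> bases2 C \<longleftrightarrow> Bt \<in> bases2 Ct) \<and>
          (A1 B \<in> FC C \<longrightarrow> P ** A1 B ** transpose P = A1 Bt \<and> A1 Bt \<in> FC Ct) \<and>
          (A2 B \<in> FC C \<longrightarrow> P ** A2 B ** transpose P = A2 Bt \<and> A2 Bt \<in> FC Ct)"
    if B: "B \<in> bases C" for B
    using bases_image[OF inj_ext1_matrix_vector_mult[OF P] B] bases2_ext1_image_iff[OF P B]
      A1_ext1_image[OF P] A2_ext1_image[OF P] FC
    unfolding Let_def Ct by (metis image_eqI)
  with P Ct FC show ?thesis
    by blast
qed

end
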